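(* Let $X,U$ be Banach spaces, let $A:D(A)\to X$ generate a $C_0$-semigroup on $X$, let $B\in L(U,X)$, and let $C:X\times U\to X$ be a map for which there exist $K>0$ and $\xi\in\mathcal{K}$ such that $\|C(x,u)\|_X\le K\|x\|_X\,\xi(\|u\|_U)$ for all $x\in X$ and all $u\in U$. Assume that $f(x,u):=Bu+C(x,u)$ is Lipschitz continuous on bounded subsets of $X$, uniformly with respect to the second argument, and that $f(x,\cdot)$ is continuous for every $x\in X$. Consider the system $$\dot x(t)=Ax(t)+Bu(t)+C(x(t),u(t)),\qquad x(0)=\phi_0 .$$ Then this system is integral input-to-state stable (iISS) if and only if it is 0-UGASs (globally asymptotically stable at zero uniformly with respect to state).
   Context: $\mathbb{R}_+=[0,\infty)$; $L(U,X)$ is the space of bounded linear operators from $U$ to $X$. Admissible inputs are $u\in U_c=C_b(\mathbb{R}_+,U)$, the bounded continuous functions $\mathbb{R}_+\to U$ with the supremum norm. Solutions are mild solutions: continuous $x$ with $x(t)=T(t)x(0)+\int_0^tT(t-s)f(x(s),u(s))\,ds$, where $\{T(t)\}_{t\ge0}$ is the $C_0$-semigroup generated by $A$. $\phi(t,\phi_0,u)$ denotes the state at time $t\ge 0$ of the solution with initial condition $\phi_0\in X$ at $t=0$ and input $u$. $f:X\times U\to X$ is Lipschitz continuous on bounded subsets of $X$, uniformly w.r.t. the second argument, if for every $w>0$ there is $L(w)>0$ such that $\|f(y,v)-f(x,v)\|_X\le L(w)\|y-x\|_X$ for all $x,y$ with $\|x\|_X\le w$, $\|y\|_X\le w$ and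 all $v\in U$. Comparison functions: $\mathcal{K}$ = continuous strictly increasing $\gamma:\mathbb{R}_+\to\mathbb{R}_+$ with $\gamma(0)=0$; $\mathcal{K}_\infty$ = unbounded functions in $\mathcal{K}$; $\mathcal{L}$ = continuous strictly decreasing $\gamma:\mathbb{R}_+\to\mathbb{R}_+$ with $\lim_{t\to\infty}\gamma(t)=0$; $\mathcal{KL}$ = continuous $\beta:\mathbb{R}_+\times\mathbb{R}_+\to\mathbb{R}_+$ with $\beta(\cdot,t)\in\mathcal{K}$ for all $t\ge0$ and $\beta(r,\cdot)\in\mathcal{L}$ for all $r>0$. 0-UGASs: there is $\beta\in\mathcal{KL}$ such that $\|\phi(t,\phi_0,0)\|_X\le\beta(\|\phi_0\|_X,t)$ for all $\phi_0\in X$ and all $t\ge0$. iISS: there are $\theta\in\mathcal{K}_\infty$, $\mu\in\mathcal{K}$, $\beta\in\mathcal{KL}$ such that $\|\phi(t,\phi_0,u)\|_X\le\beta(\|\phi_0\|_X,t)+\theta\left(\int_0^t\mu(\|u(s)\|_U)\,ds\right)$ for all $\phi_0\in X$, all $u\in U_c$ and all $t\ge0$ (in particular solutions exist for all $t\ge 0$). *)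

theory Defs
  imports "HOL-Analysis.Analysis"
begin

text \<open>
  Maps defined on the half-line are total functions on \<^typ>\<open>real\<close> of which only the values
  on \<^term>\<open>{0::real..}\<close> matter.
\<close>

definition class_K :: "(real \<Rightarrow> real) set" where
  "class_K = {\<gamma>. continuous_on {0..} \<gamma> \<and> strict_mono_on {0..} \<gamma> \<and> \<gamma> ` {0..} \<subseteq> {0..} \<and> \<gamma> 0 = 0}"

definition class_Kinf :: "(real \<Rightarrow> real) set" where
  "class_Kinf = {\<gamma> \<in> class_K. \<not> bounded (\<gamma> ` {0..})}"

definition class_L :: "(real \<Rightarrow> real) set" where
  "class_L = {\<gamma>. continuous_on {0..} \<gamma> \<and> strict_antimono_on {0..} \<gamma> \<and> \<gamma> ` {0..} \<subseteq> {0..}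
                 \<and> (\<gamma> \<longlongrightarrow> 0) at_top}"

definition class_KL :: "(real \<Rightarrow> real \<Rightarrow> real) set" where
  "class_KL = {\<beta>. continuous_on ({0..} \<times> {0..}) (\<lambda>(r, t). \<beta> r t)
                  \<and> (\<forall>r\<ge>0. \<forall>t\<ge>0. \<beta> r t \<ge> 0)
                  \<and> (\<forall>t\<ge>0. (\<lambda>r. \<beta> r t) \<in> class_K)
                  \<and> (\<forall>r>0. \<beta> r \<in> class_L)}"

definition C0_semigroup :: "(real \<Rightarrow> 'x \<Rightarrow>\<^sub>L 'x::banach) \<Rightarrow> bool" where
  "C0_semigroup T \<longleftrightarrow>
     T 0 = id_blinfun
     \<and> (\<forall>s\<ge>0. \<forall>t\<ge>0. T (s + t) = T s o\<^sub>L T t)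
     \<and> (\<forall>x. ((\<lambda>t. T t x) \<longlongrightarrow> x) (at_right 0))"

text \<open>The generator is the unbounded operator with domain \<open>D\<close>; the values of \<open>A\<close> outside \<open>D\<close>
  are irrelevant.\<close>

definition generates_C0_semigroup ::
  "'x set \<Rightarrow> ('x \<Rightarrow> 'x) \<Rightarrow> (real \<Rightarrow> 'x \<Rightarrow>\<^sub>L 'x::banach) \<Rightarrow> bool" where
  "generates_C0_semigroup D A T \<longleftrightarrow>
     C0_semigroup T
     \<and> D = {x. \<exists>y. ((\<lambda>h. (T h x - x) /\<^sub>R h) \<longlongrightarrow> y) (at_right 0)}
     \<and> (\<forall>x\<in>D. ((\<lambda>h. (T h x - x) /\<^sub>R h) \<longlongrightarrow> A x) (at_right 0))"

definition admissible_inputs :: "(real \<Rightarrow> 'u::banach) set" where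
  "admissible_inputs = {u. continuous_on {0..} u \<and> bounded (u ` {0..})}"

definition lipschitz_on_bounded_uniformly :: "('x::banach \<Rightarrow> 'u::banach \<Rightarrow> 'x) \<Rightarrow> bool" where
  "lipschitz_on_bounded_uniformly f \<longleftrightarrow>
     (\<forall>w>0. \<exists>L>0. \<forall>v. \<forall>x y. norm x \<le> w \<longrightarrow> norm y \<le> w \<longrightarrow>
        norm (f y v - f x v) \<le> L * norm (y - x))"

text \<open>The integrand takes values in a Banach space that need not be separable, hence the gauge
  integral; for continuous integrands it is the Riemann integral.\<close>

definition mild_solution ::
  "(real \<Rightarrow> 'x \<Rightarrow>\<^sub>L 'x::banach) \<Rightarrow> ('x \<Rightarrow> 'u::banach \<Rightarrow> 'x) \<Rightarrow> 'x \<Rightarrow> (real \<Rightarrow> 'u) \<Rightarrow> (real \<Rightarrow> 'x) \<Rightarrow> bool"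
where
  "mild_solution T f \<phi>0 u x \<longleftrightarrow>
     continuous_on {0..} x \<and> x 0 = \<phi>0
     \<and> (\<forall>t\<ge>0. (\<lambda>s. T (t - s) (f (x s) (u s))) integrable_on {0..t}
            \<and> x t = T t (x 0) + integral {0..t} (\<lambda>s. T (t - s) (f (x s) (u s))))"

text \<open>
  The bound on \<open>\<phi>(t, \<phi>0, u)\<close> for all \<open>t \<ge> 0\<close> presupposes that the solution exists on the whole
  half-line, which is made explicit below. The bound is imposed on every mild solution, of which
  there is only one when \<open>f\<close> is Lipschitz on bounded sets.
\<close>

definition zero_UGASs ::
  "(real \<Rightarrow> 'x \<Rightarrow>\<^sub>L 'x::banach) \<Rightarrow> ('x \<Rightarrow> 'u::banach \<Rightarrow> 'x) \<Rightarrow> bool" where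
  "zero_UGASs T f \<longleftrightarrow>
     (\<exists>\<beta>\<in>class_KL. \<forall>\<phi>0.
        (\<exists>x. mild_solution T f \<phi>0 (\<lambda>_. 0) x)
        \<and> (\<forall>x. mild_solution T f \<phi>0 (\<lambda>_. 0) x \<longrightarrow> (\<forall>t\<ge>0. norm (x t) \<le> \<beta> (norm \<phi>0) t)))"

definition iISS ::
  "(real \<Rightarrow> 'x \<Rightarrow>\<^sub>L 'x::banach) \<Rightarrow> ('x \<Rightarrow> 'u::banach \<Rightarrow> 'x) \<Rightarrow> bool" where
  "iISS T f \<longleftrightarrow>
     (\<exists>\<theta>\<in>class_Kinf. \<exists>\<mu>\<in>class_K. \<exists>\<beta>\<in>class_KL. \<forall>\<phi>0. \<forall>u\<in>admissible_inputs.
        (\<exists>x. mild_solution T f \<phi>0 u x)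
        \<and> (\<forall>x. mild_solution T f \<phi>0 u x \<longrightarrow>
              (\<forall>t\<ge>0. norm (x t) \<le> \<beta> (norm \<phi>0) t + \<theta> (integral {0..t} (\<lambda>s. \<mu> (norm (u s)))))))"

end

theory Submission imports Defs begin

text \<open>
  Since \<open>C(x, 0) = 0\<close>, the undisturbed system is linear, so 0-UGASs forces
  \<open>\<parallel>T(t)\<parallel> \<le> M exp (- \<omega> t)\<close>. Gronwall's inequality for \<open>exp (\<omega> t) \<parallel>x(t)\<parallel>\<close> then gives
  \<open>\<parallel>x(t)\<parallel> \<le> (r + a I) exp (k I)\<close>, where \<open>r = M exp (- \<omega> t) \<parallel>x(0)\<parallel>\<close> and \<open>I\<close> is the integral of
  \<open>\<parallel>u\<parallel> + \<xi>(\<parallel>u\<parallel>)\<close> over \<open>[0, t]\<close>. The mixed term is separated by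
  \<open>r (exp (k I) - 1) \<le> r\<^sup>2 / 2 + (exp (k I) - 1)\<^sup>2 / 2\<close>. The same bound excludes blow-up, which gives
  global existence of solutions.
\<close>

section \<open>Gronwall's inequality and continuity on the half-line\<close>

text \<open>With \<open>W\<close> the right-hand side of the hypothesis,
  \<open>Z = W exp (- \<integral> h)\<close> has derivative
  \<open>h exp (- \<integral> h) (y - W)\<close>, which is nonpositive because
  \<open>h \<ge> 0\<close> and \<open>y \<le> W\<close>. Hence
  \<open>Z t \<le> Z 0 = a\<close>.\<close>

lemma gronwall_integral:
  fixes y h :: "real \<Rightarrow> real"
  assumes t: "0 \<le> t"
    and y: "continuous_on {0..t} y" and h: "continuous_on {0..t} h"
    and h_nonneg: "\<And>s. s \<in> {0..t} \<Longrightarrow> 0 \<le> h s"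
    and le: "\<And>s. s \<in> {0..t} \<Longrightarrow> y s \<le> a + integral {0..s} (\<lambda>r. h r * y r)"
  shows "y t \<le> a * exp (integral {0..t} h)"
proof -
  define W where "W s = a + integral {0..s} (\<lambda>r. h r * y r)" for s
  define Z where "Z s = W s * exp (- integral {0..s} h)" for s
  have hy: "continuous_on {0..t} (\<lambda>r. h r * y r)"
    by (intro continuous_intros y h)
  have "Z t \<le> Z 0"
  proof (rule DERIV_nonpos_imp_decreasing_open[OF t])
    show "continuous_on {0..t} Z"
      unfolding Z_def W_def
      by (intro continuous_intros indefinite_integral_continuous_1 integrable_continuous_real hy h)
    fix s assume s: "0 < s" "s < t"
    then have at: "at s within {0..t} = at s"
      by (intro at_within_interior) auto
    have "((\<lambda>x. integral {0..x} h) has_real_derivative h s) (at s within {0..t})"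
      "((\<lambda>x. integral {0..x} (\<lambda>r. h r * y r)) has_real_derivative h s * y s) (at s within {0..t})"
      using integral_has_real_derivative[OF h, of s] integral_has_real_derivative[OF hy, of s] s
      by auto
    then have "(Z has_real_derivative
        (h s * y s) * exp (- integral {0..s} h) + W s * (exp (- integral {0..s} h) * (- h s))) (at s)"
      unfolding at Z_def W_def by (auto intro!: derivative_eq_intros)
    moreover have "(h s * y s) * exp (- integral {0..s} h) + W s * (exp (- integral {0..s} h) * (- h s))
        = h s * exp (- integral {0..s} h) * (y s - W s)"
      by (simp add: algebra_simps)
    moreover have "\<dots> \<le> 0"
      using le[of s] h_nonneg[of s] s by (auto intro!: mult_nonneg_nonpos simp: W_def)
    ultimately show "\<exists>d. (Z has_real_derivative d) (at s) \<and> d \<le> 0"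
      by metis
  qed
  then have "W t \<le> a * exp (integral {0..t} h)"
    by (simp add: Z_def W_def exp_minus divide_simps)
  with le[of t] t show ?thesis
    by (simp add: W_def)
qed

text \<open>Continuity at \<open>t\<close> only depends on values in \<open>{0..t+1}\<close>.
  Indefinite integrals and locally uniform limits are first shown continuous on compact
  intervals.\<close>

lemma continuous_on_halfline:
  fixes g :: "real \<Rightarrow> 'a::topological_space"
  assumes "\<And>N. continuous_on {0..N} g"
  shows "continuous_on {0..} g"
  unfolding continuous_on_eq_continuous_within
proof
  fix t :: real assume "t \<in> {0..}"
  then have "continuous (at t within {0..t+1}) g"
    using assms[of "t + 1"] by (auto simp: continuous_on_eq_continuous_within)
  moreover have "at t within {0..} = at t within {0..t+1}"
    by (rule at_within_nhd[of _ "{..<t+1}"]) auto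
  ultimately show "continuous (at t within {0..}) g" by simp
qed

section \<open>Exponentially stable operator families and their convolutions\<close>

text \<open>The properties of the semigroup on which the solution theory rests; the decay bound
  comes from \<open>C0_semigroup_exp_stable\<close>.\<close>

locale exp_stable_family =
  fixes T :: "real \<Rightarrow> 'x::banach \<Rightarrow>\<^sub>L 'x" and M \<omega> :: real
  assumes cont: "\<And>x. continuous_on {0..} (\<lambda>t. T t x)"
    and bound: "\<And>t. 0 \<le> t \<Longrightarrow> norm (T t) \<le> M * exp (- \<omega> * t)"
    and at_zero: "T 0 = id_blinfun"
    and M_pos: "0 < M" and rate_pos: "0 < \<omega>"
begin

lemma bound_M: "0 \<le> t \<Longrightarrow> norm (T t) \<le> M"
  using bound[of t] M_pos rate_pos
  by (smt (verit) exp_le_one_iff mult_left_le mult_nonneg_nonneg mult_minus_left)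

lemma norm_apply_le: "0 \<le> t \<Longrightarrow> norm (T t x) \<le> M * norm x"
  by (meson bound_M mult_right_mono norm_blinfun norm_ge_zero order_trans)

lemma norm_apply_exp_le: "0 \<le> t \<Longrightarrow> norm (T t x) \<le> M * exp (- \<omega> * t) * norm x"
  by (meson bound mult_right_mono norm_blinfun norm_ge_zero order_trans)

text \<open>The operators are \<open>M\<close>-Lipschitz with one constant for all times; together
  with continuity of every orbit this yields joint continuity.\<close>

lemma continuous_on_pair: "continuous_on ({0..} \<times> UNIV) (\<lambda>(t, x). T t x)"
proof (rule Lipschitz.continuous_on_TimesI)
  show "local_lipschitz {0..} UNIV (\<lambda>t. blinfun_apply (T t))"
  proof (rule local_lipschitzI)
    fix t :: real and x :: 'x
    have "M-lipschitz_on (cball x 1 \<inter> UNIV) (blinfun_apply (T s))" if "s \<in> cball t 1 \<inter> {0..}" for s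
      using that M_pos norm_apply_le[of s]
      by (intro lipschitz_onI) (auto simp: dist_norm simp flip: blinfun.diff_right)
    then show "\<exists>u>0. \<exists>L. \<forall>s\<in>cball t u \<inter> {0..}. L-lipschitz_on (cball x u \<inter> UNIV) (blinfun_apply (T s))"
      by (intro exI[of _ "1::real"] conjI exI[of _ M] ballI) simp_all
  qed
qed (use cont in auto)

lemma continuous_on_apply:
  assumes "continuous_on S a" "continuous_on S g" "\<And>s. s \<in> S \<Longrightarrow> 0 \<le> a s"
  shows "continuous_on S (\<lambda>s. T (a s) (g s))"
proof -
  have "continuous_on S (\<lambda>s. (\<lambda>(t, x). T t x) (a s, g s))"
    by (rule continuous_on_compose2[OF continuous_on_pair]) (use assms in \<open>auto intro: continuous_on_Pair\<close>)
  then show ?thesis by simp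
qed

text \<open>The Duhamel term of the mild solution formula, for a forcing \<open>g\<close> that
  depends on time alone.\<close>

definition convolution :: "(real \<Rightarrow> 'x) \<Rightarrow> real \<Rightarrow> 'x" where
  "convolution g t = integral {0..t} (\<lambda>s. T (t - s) (g s))"

lemma continuous_on_integrand:
  assumes "continuous_on {0..} g"
  shows "continuous_on {0..t} (\<lambda>s. T (t - s) (g s))"
  by (intro continuous_on_apply continuous_intros continuous_on_subset[OF assms]) auto

lemma convolution_integrable:
  assumes "continuous_on {0..} g"
  shows "(\<lambda>s. T (t - s) (g s)) integrable_on {0..t}"
  by (rule integrable_continuous_real[OF continuous_on_integrand[OF assms]])

text \<open>The substitution \<open>s = t \<sigma>\<close> makes the domain of integration independent of \<open>t\<close>.\<close>

lemma continuous_on_convolution: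
  assumes g: "continuous_on {0..} g"
  shows "continuous_on {0..} (convolution g)"
proof -
  have eq: "t *\<^sub>R integral {0..1} (\<lambda>\<sigma>. T (t - t * \<sigma>) (g (t * \<sigma>))) = convolution g t" if "t \<in> {0..}" for t
  proof (cases "t = 0")
    case True
    then show ?thesis by (simp add: convolution_def)
  next
    case False
    with that have t: "t > 0" by auto
    have "((\<lambda>s. T (t - s) (g s)) has_integral convolution g t) {0..t}"
      unfolding convolution_def by (rule integrable_integral[OF convolution_integrable[OF g]])
    from has_integral_stretch_real[OF this, of t] t
    have "((\<lambda>\<sigma>. T (t - t * \<sigma>) (g (t * \<sigma>))) has_integral (1 / t) *\<^sub>R convolution g t) ((\<lambda>x. x / t) ` {0..t})"
      by simp
    moreover have "(\<lambda>x. x / t) ` {0..t} = {0..1}"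
      using t by (auto simp: image_iff divide_simps intro!: bexI[of _ "_ * t"])
    ultimately have "integral {0..1} (\<lambda>\<sigma>. T (t - t * \<sigma>) (g (t * \<sigma>))) = (1 / t) *\<^sub>R convolution g t"
      by (simp add: integral_unique)
    then show ?thesis using t by simp
  qed
  have "continuous_on ({0..} \<times> cbox 0 1) (\<lambda>(t, \<sigma>). T (t - t * \<sigma>) (g (t * \<sigma>)))"
    unfolding case_prod_beta
    by (intro continuous_on_apply continuous_on_compose2[OF g] continuous_intros)
      (auto simp: mult_left_le)
  from integral_continuous_on_param[OF this]
  have "continuous_on {0..} (\<lambda>t. t *\<^sub>R integral {0..1} (\<lambda>\<sigma>. T (t - t * \<sigma>) (g (t * \<sigma>))))"
    by (intro continuous_intros) (auto simp: cbox_interval)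
  then show ?thesis
    by (rule continuous_on_eq) (use eq in auto)
qed

lemma convolution_diff:
  assumes "continuous_on {0..} g" "continuous_on {0..} h"
  shows "convolution g t - convolution h t = convolution (\<lambda>s. g s - h s) t"
  unfolding convolution_def
  by (subst integral_diff[symmetric])
     (auto simp: blinfun.diff_right intro!: convolution_integrable assms)

text \<open>The decay is discarded in favour of the uniform bound \<open>M\<close>, which suffices
  for the iteration on bounded time intervals.\<close>

lemma norm_convolution_le:
  assumes t: "0 \<le> t" and g: "continuous_on {0..} g"
    and h: "h integrable_on {0..t}" and le: "\<And>s. s \<in> {0..t} \<Longrightarrow> norm (g s) \<le> h s"
  shows "norm (convolution g t) \<le> M * integral {0..t} h"
proof -
  have "norm (convolution g t) \<le> integral {0..t} (\<lambda>s. M * h s)"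
    unfolding convolution_def
  proof (rule Henstock_Kurzweil_Integration.integral_norm_bound_integral[OF convolution_integrable[OF g]])
    show "(\<lambda>s. M * h s) integrable_on {0..t}"
      using h by (intro integrable_on_mult_right)
    fix s assume s: "s \<in> {0..t}"
    then have "norm (T (t - s) (g s)) \<le> M * norm (g s)"
      by (intro norm_apply_le) auto
    also have "\<dots> \<le> M * h s"
      using le[OF s] M_pos by simp
    finally show "norm (T (t - s) (g s)) \<le> M * h s" .
  qed
  then show ?thesis by simp
qed

section \<open>A priori estimate by weighted Gronwall\<close>

text \<open>Gronwall is applied to \<open>y s = exp (\<omega> s) \<parallel>x s\<parallel>\<close>,
  since the weight turns the decaying kernel into a constant one. The forcing is an arbitrary
  \<open>g\<close> with a growth bound along \<open>x\<close>, so that the estimate serves both the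
  original and the truncated nonlinearity.\<close>

lemma mild_estimate:
  assumes t: "0 \<le> t" and x: "continuous_on {0..} x" and g: "continuous_on {0..} g"
    and p: "continuous_on {0..} p" and q: "continuous_on {0..} q"
    and p_nonneg: "\<And>s. 0 \<le> s \<Longrightarrow> 0 \<le> p s" and q_nonneg: "\<And>s. 0 \<le> s \<Longrightarrow> 0 \<le> q s"
    and growth: "\<And>s. 0 \<le> s \<Longrightarrow> norm (g s) \<le> p s + norm (x s) * q s"
    and eq: "\<And>s. 0 \<le> s \<Longrightarrow> x s = T s x0 + convolution g s"
  shows "norm (x t) \<le> (M * exp (- \<omega> * t) * norm x0 + M * integral {0..t} p) * exp (M * integral {0..t} q)"
proof -
  note sub = continuous_on_subset[where s = "{0..}"]
  define y where "y s = exp (\<omega> * s) * norm (x s)" for s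
  \<comment> \<open>Weight and integral of \<open>p\<close> are taken at the final time
    \<open>t\<close>, so that \<open>a\<close> does not depend on \<open>s\<close>. The factor
    \<open>exp (- \<omega> * t)\<close> obtained at the end cancels the weight.\<close>
  define a where "a = M * norm x0 + M * (exp (\<omega> * t) * integral {0..t} p)"
  have cy: "continuous_on {0..} y"
    unfolding y_def by (intro continuous_intros x)
  have "y t \<le> a * exp (integral {0..t} (\<lambda>s. M * q s))"
  proof (rule gronwall_integral[OF t])
    show "continuous_on {0..t} y" by (rule sub[OF cy]) auto
    show "continuous_on {0..t} (\<lambda>s. M * q s)"
      by (intro continuous_intros sub[OF q]) auto
    show "0 \<le> M * q s" if "s \<in> {0..t}" for s
      using that M_pos q_nonneg by simp
    fix s assume s: "s \<in> {0..t}"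
    have int_q: "(\<lambda>r. M * q r * y r) integrable_on {0..s}"
      by (intro integrable_continuous_real continuous_intros sub[OF q] sub[OF cy]) auto
    have int_p: "p integrable_on {0..r}" for r
      by (intro integrable_continuous_real sub[OF p]) auto
    have "norm (convolution g s) \<le> integral {0..s} (\<lambda>r. exp (- \<omega> * s) * (M * (exp (\<omega> * t) * p r) + M * q r * y r))"
      unfolding convolution_def
    proof (rule Henstock_Kurzweil_Integration.integral_norm_bound_integral[OF convolution_integrable[OF g]])
      show "(\<lambda>r. exp (- \<omega> * s) * (M * (exp (\<omega> * t) * p r) + M * q r * y r)) integrable_on {0..s}"
        by (intro integrable_on_mult_right integrable_add int_q int_p)
      fix r assume r: "r \<in> {0..s}"
      have "norm (T (s - r) (g r)) \<le> M * exp (- \<omega> * (s - r)) * norm (g r)"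
        using r by (intro norm_apply_exp_le) auto
      also have "\<dots> \<le> M * exp (- \<omega> * (s - r)) * (p r + norm (x r) * q r)"
        using r M_pos growth[of r] by (intro mult_left_mono) auto
      \<comment> \<open>The kernel splits into \<open>exp (- \<omega> * s)\<close>, which leaves the
        integral, and \<open>exp (\<omega> * r)\<close>, which turns \<open>norm (x r)\<close> into
        \<open>y r\<close>.\<close>
      also have "\<dots> = exp (- \<omega> * s) * (M * (exp (\<omega> * r) * p r) + M * q r * y r)"
      proof -
        have "exp (- \<omega> * (s - r)) = exp (- \<omega> * s) * exp (\<omega> * r)"
          by (simp add: mult_exp_exp algebra_simps)
        then show ?thesis by (simp add: y_def algebra_simps)
      qed
      \<comment> \<open>Here \<open>r \<le> s \<le> t\<close>, and only the weight of
        \<open>p\<close> is enlarged; the term with \<open>y\<close> keeps its own weight.\<close>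
      also have "\<dots> \<le> exp (- \<omega> * s) * (M * (exp (\<omega> * t) * p r) + M * q r * y r)"
        using r s M_pos rate_pos p_nonneg[of r]
        by (intro mult_left_mono add_right_mono mult_right_mono) auto
      finally show "norm (T (s - r) (g r)) \<le> exp (- \<omega> * s) * (M * (exp (\<omega> * t) * p r) + M * q r * y r)" .
    qed
    also have "\<dots> = exp (- \<omega> * s) * (M * (exp (\<omega> * t) * integral {0..s} p) + integral {0..s} (\<lambda>r. M * q r * y r))"
      by (subst integral_mult_right, subst integral_add)
        (auto intro!: int_q int_p integrable_on_mult_right)
    also have "\<dots> \<le> exp (- \<omega> * s) * (M * (exp (\<omega> * t) * integral {0..t} p) + integral {0..s} (\<lambda>r. M * q r * y r))"
      using M_pos s p_nonneg
      by (intro mult_left_mono add_right_mono integral_subset_le int_p) auto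
    finally have "norm (x s) \<le> exp (- \<omega> * s) * (M * norm x0)
        + exp (- \<omega> * s) * (M * (exp (\<omega> * t) * integral {0..t} p) + integral {0..s} (\<lambda>r. M * q r * y r))"
      using eq[of s] s norm_apply_exp_le[of s x0] norm_triangle_ineq[of "T s x0" "convolution g s"]
      by (simp add: algebra_simps)
    then have "norm (x s) \<le> exp (- \<omega> * s) * (a + integral {0..s} (\<lambda>r. M * q r * y r))"
      by (simp add: a_def algebra_simps)
    then show "y s \<le> a + integral {0..s} (\<lambda>r. M * q r * y r)"
      by (simp add: y_def exp_minus divide_simps mult.commute)
  qed
  then have "norm (x t) \<le> exp (- \<omega> * t) * a * exp (M * integral {0..t} q)"
    by (simp add: y_def exp_minus divide_simps mult.commute)
  also have "exp (- \<omega> * t) * a = M * exp (- \<omega> * t) * norm x0 + M * integral {0..t} p"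
    by (simp add: a_def algebra_simps exp_minus)
  finally show ?thesis .
qed


section \<open>Picard iteration for globally Lipschitz nonlinearities\<close>

text \<open>On each \<open>{0..N}\<close> the iteration halves distances in the norm weighted by
  \<open>exp (- a * t)\<close>, \<open>a = 2 * M * L\<close> (Bielecki's norm). No smallness of the
  interval is required, so the Lipschitz constant may grow with \<open>N\<close> and the solution is
  still global.\<close>

theorem integral_equation_solution:
  assumes F_cont: "\<And>x. continuous_on {0..} x \<Longrightarrow> continuous_on {0..} (\<lambda>s. F s (x s))"
    and lip: "\<And>N::real. \<exists>L>0. \<forall>s\<in>{0..N}. \<forall>x y. norm (F s x - F s y) \<le> L * norm (x - y)"
  shows "\<exists>x. continuous_on {0..} x \<and> (\<forall>t\<ge>0. x t = T t x0 + convolution (\<lambda>s. F s (x s)) t)"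
proof -
  \<comment> \<open>Starting from the zero function makes \<open>X n\<close> the sum of the first
    \<open>n\<close> differences \<open>D i\<close>.\<close>
  define X where "X = rec_nat (\<lambda>_. 0) (\<lambda>_ x t. T t x0 + convolution (\<lambda>s. F s (x s)) t)"
  have X_0: "X 0 = (\<lambda>_. 0)"
    and X_Suc: "X (Suc n) t = T t x0 + convolution (\<lambda>s. F s (X n s)) t" for n t
    by (simp_all add: X_def)
  have cont_X: "continuous_on {0..} (X n)" for n
  proof (induction n)
    case (Suc n)
    then show ?case
      unfolding X_Suc by (intro continuous_intros cont continuous_on_convolution F_cont)
  qed (simp add: X_0)
  define D where "D n t = X (Suc n) t - X n t" for n t
  define x where "x t = (\<Sum>i. D i t)" for t
  have X_sum: "X n = (\<lambda>t. \<Sum>i<n. D i t)" for n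
    unfolding D_def by (rule ext, subst sum_lessThan_telescope) (simp add: X_0)
  have D_bound: "\<exists>c. \<forall>n. \<forall>t\<in>{0..N}. norm (D n t) \<le> c * (1/2) ^ n" for N
  proof -
    obtain L where L: "L > 0" "\<And>s x y. s \<in> {0..N} \<Longrightarrow> norm (F s x - F s y) \<le> L * norm (x - y)"
      using lip by meson
    have "continuous_on {0..N} (D 0)"
      unfolding D_def by (intro continuous_intros continuous_on_subset[OF cont_X]) auto
    then have "bounded (D 0 ` {0..N})"
      by (intro compact_imp_bounded compact_continuous_image) auto
    then obtain c where c: "c > 0" "\<And>t. t \<in> {0..N} \<Longrightarrow> norm (D 0 t) \<le> c"
      unfolding bounded_pos by auto
    \<comment> \<open>The integral of \<open>b * exp (a * s)\<close> contributes
      \<open>b / a\<close>; this choice makes \<open>M * (b / a)\<close> exactly half of the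
      previous coefficient.\<close>
    define a where "a = 2 * M * L"
    have a: "a > 0" using L M_pos by (simp add: a_def)
    have exp_bound: "norm (D n t) \<le> c * (1/2) ^ n * exp (a * t)" if "t \<in> {0..N}" for n t
      using that
    proof (induction n arbitrary: t)
      case 0
      then have "c * 1 \<le> c * exp (a * t)"
        using a c by (intro mult_left_mono) auto
      with c(2)[OF 0] show ?case by simp
    next
      case (Suc n)
      define b where "b = L * (c * (1/2) ^ n)"
      have b: "b > 0" using c L by (simp add: b_def)
      have t: "0 \<le> t" using Suc by simp
      have "((\<lambda>s. b * exp (a * s)) has_integral (b / a * exp (a * t) - b / a * exp (a * 0))) {0..t}"
        using t a
        by (intro fundamental_theorem_of_calculus)
          (auto intro!: derivative_eq_intros simp flip: has_real_derivative_iff_has_vector_derivative)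
      note int = this
      have "D (Suc n) t = convolution (\<lambda>s. F s (X (Suc n) s) - F s (X n s)) t"
        unfolding D_def X_Suc[of "Suc n"] X_Suc[of n t]
        by (simp add: convolution_diff F_cont cont_X)
      also have "norm \<dots> \<le> M * integral {0..t} (\<lambda>s. b * exp (a * s))"
      proof (rule norm_convolution_le[OF t])
        show "continuous_on {0..} (\<lambda>s. F s (X (Suc n) s) - F s (X n s))"
          by (intro continuous_intros F_cont cont_X)
        show "(\<lambda>s. b * exp (a * s)) integrable_on {0..t}"
          using int by blast
        fix s assume "s \<in> {0..t}"
        then have s: "s \<in> {0..N}" using Suc by auto
        have "norm (F s (X (Suc n) s) - F s (X n s)) \<le> L * norm (D n s)"
          unfolding D_def by (rule L(2)[OF s])
        also have "\<dots> \<le> L * (c * (1/2) ^ n * exp (a * s))"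
          using Suc.IH[OF s] L(1) by simp
        finally show "norm (F s (X (Suc n) s) - F s (X n s)) \<le> b * exp (a * s)"
          by (simp add: b_def mult.assoc)
      qed
      also have "\<dots> = M * (b / a) * (exp (a * t) - 1)"
        unfolding integral_unique[OF int] by (simp add: algebra_simps)
      also have "M * (b / a) = c * (1/2) ^ Suc n"
        using L M_pos by (simp add: a_def b_def)
      also have "c * (1/2) ^ Suc n * (exp (a * t) - 1) \<le> c * (1/2) ^ Suc n * exp (a * t)"
        using c by (intro mult_left_mono) auto
      finally show ?case .
    qed
    have "norm (D n t) \<le> c * exp (a * N) * (1/2) ^ n" if "t \<in> {0..N}" for n t
    proof -
      have "c * (1/2) ^ n * exp (a * t) \<le> c * (1/2) ^ n * exp (a * N)"
        using that a c by (intro mult_left_mono) auto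
      with exp_bound[OF that, of n] show ?thesis by (simp add: mult_ac)
    qed
    then show ?thesis by blast
  qed
  \<comment> \<open>The geometric bound on the differences is the majorant of the Weierstrass test,
    giving convergence uniform on each compact interval.\<close>
  have X_lim: "uniform_limit {0..N} X x sequentially" for N
  proof -
    obtain c where c: "\<And>n t. t \<in> {0..N} \<Longrightarrow> norm (D n t) \<le> c * (1/2) ^ n"
      using D_bound by meson
    show ?thesis
      unfolding X_sum x_def
      by (rule Weierstrass_m_test[OF c]) (auto intro!: summable_mult summable_geometric)
  qed
  have cont_x: "continuous_on {0..} x"
  proof (rule continuous_on_halfline)
    show "continuous_on {0..N} x" for N
      by (rule uniform_limit_theorem[OF _ X_lim])
        (auto intro!: always_eventually continuous_on_subset[OF cont_X])
  qed
  have "x t = T t x0 + convolution (\<lambda>s. F s (x s)) t" if t: "0 \<le> t" for t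
  proof (rule LIMSEQ_unique)
    have "(\<lambda>n. X n t) \<longlonglongrightarrow> x t"
      using t by (intro tendsto_uniform_limitI[OF X_lim[of t]]) auto
    then show "(\<lambda>n. X (Suc n) t) \<longlonglongrightarrow> x t"
      by (rule LIMSEQ_Suc)
    obtain L where L: "L > 0" "\<And>s x y. s \<in> {0..t} \<Longrightarrow> norm (F s x - F s y) \<le> L * norm (x - y)"
      using lip by meson
    have "(\<lambda>n. convolution (\<lambda>s. F s (X n s)) t) \<longlonglongrightarrow> convolution (\<lambda>s. F s (x s)) t"
    proof (rule tendstoI)
      fix r :: real assume r: "r > 0"
      \<comment> \<open>The summand 1 keeps \<open>k\<close> positive also for \<open>t = 0\<close>
        and makes the final inequality strict.\<close>
      define k where "k = M * L * t + 1"
      have k: "k > 0" using L M_pos t by (simp add: k_def add_nonneg_pos)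
      then have "r / k > 0" using r by simp
      from uniform_limitD[OF X_lim[of t] this]
      show "\<forall>\<^sub>F n in sequentially. dist (convolution (\<lambda>s. F s (X n s)) t) (convolution (\<lambda>s. F s (x s)) t) < r"
      proof eventually_elim
        case (elim n)
        have "norm (convolution (\<lambda>s. F s (X n s) - F s (x s)) t) \<le> M * integral {0..t} (\<lambda>s. L * (r / k))"
        proof (rule norm_convolution_le[OF t])
          show "continuous_on {0..} (\<lambda>s. F s (X n s) - F s (x s))"
            by (intro continuous_intros F_cont cont_X cont_x)
          fix s assume s: "s \<in> {0..t}"
          have "norm (F s (X n s) - F s (x s)) \<le> L * norm (X n s - x s)"
            by (rule L(2)[OF s])
          also have "\<dots> \<le> L * (r / k)"
            using elim s L(1) by (intro mult_left_mono) (auto simp: dist_norm less_imp_le)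
          finally show "norm (F s (X n s) - F s (x s)) \<le> L * (r / k)" .
        qed (rule integrable_const_ivl)
        also have "\<dots> = (M * L * t) * (r / k)"
          using t by simp
        also have "\<dots> < k * (r / k)"
          using k r by (intro mult_strict_right_mono) (auto simp: k_def)
        also have "\<dots> = r" using k by simp
        finally show ?case
          by (simp add: dist_norm convolution_diff F_cont cont_X cont_x)
      qed
    qed
    then show "(\<lambda>n. X (Suc n) t) \<longlonglongrightarrow> T t x0 + convolution (\<lambda>s. F s (x s)) t"
      unfolding X_Suc by (intro tendsto_intros)
  qed
  with cont_x show ?thesis by blast
qed


end

section \<open>Radial truncation and continuity of the nonlinearity along curves\<close>

text \<open>For \<open>w > 0\<close> this is the radial retraction onto the closed ball of radius
  \<open>w\<close>; the form with \<open>max\<close> avoids a case distinction in the continuity and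
  Lipschitz proofs.\<close>

definition trunc :: "real \<Rightarrow> 'a::real_normed_vector \<Rightarrow> 'a" where
  "trunc w x = (w / max w (norm x)) *\<^sub>R x"

lemma trunc_eq_self: "0 < w \<Longrightarrow> norm x \<le> w \<Longrightarrow> trunc w x = x"
  by (simp add: trunc_def max_def)

lemma norm_trunc_le:
  assumes "0 < w"
  shows "norm (trunc w x) \<le> w" "norm (trunc w x) \<le> norm x"
proof -
  have eq: "norm (trunc w x) = w * norm x / max w (norm x)"
    using assms by (simp add: trunc_def)
  show "norm (trunc w x) \<le> w" "norm (trunc w x) \<le> norm x"
    unfolding eq using assms
    by (simp_all add: pos_divide_le_eq less_max_iff_disj mult_left_mono mult.commute[of "norm x"] mult_right_mono)
qed

lemma trunc_lipschitz:
  assumes w: "0 < w"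
  shows "norm (trunc w x - trunc w y) \<le> 2 * norm (x - y)"
proof -
  define m n where "m = max w (norm x)" and "n = max w (norm y)"
  have pos: "m > 0" "n > 0" and w_le: "w \<le> m" and y_le: "norm y \<le> n"
    using w by (auto simp: m_def n_def)
  \<comment> \<open>The first summand is the scaled difference, the second the change of the scaling
    factor; each is at most \<open>norm (x - y)\<close>, whence the constant 2.\<close>
  have "trunc w x - trunc w y = (w / m) *\<^sub>R (x - y) + (w / m - w / n) *\<^sub>R y"
    by (simp add: trunc_def m_def n_def algebra_simps)
  then have "norm (trunc w x - trunc w y) \<le> norm ((w / m) *\<^sub>R (x - y)) + norm ((w / m - w / n) *\<^sub>R y)"
    by (metis norm_triangle_ineq)
  also have "\<dots> = (w / m) * norm (x - y) + \<bar>w / m - w / n\<bar> * norm y"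
    using w pos by simp
  also have "(w / m) * norm (x - y) \<le> 1 * norm (x - y)"
    using w_le pos by (intro mult_right_mono) auto
  also have "\<bar>w / m - w / n\<bar> * norm y = (w / m) * (norm y / n) * \<bar>n - m\<bar>"
  proof -
    have "w / m - w / n = (w / m) * (1 / n) * (n - m)"
      using pos by (simp add: field_simps)
    then show ?thesis
      using pos w by (simp add: abs_mult)
  qed
  also have "\<dots> \<le> 1 * \<bar>n - m\<bar>"
    using w w_le y_le pos by (intro mult_right_mono mult_le_one) auto
  also have "\<bar>n - m\<bar> \<le> norm (x - y)"
    using norm_triangle_ineq3[of x y] by (auto simp: m_def n_def max_def)
  finally show ?thesis by simp
qed

lemma continuous_on_trunc:
  assumes "continuous_on S w" "continuous_on S x" "\<And>s. s \<in> S \<Longrightarrow> 0 < w s"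
  shows "continuous_on S (\<lambda>s. trunc (w s) (x s))"
  unfolding trunc_def
  by (intro continuous_intros assms) (metis assms(3) less_max_iff_disj less_irrefl)

text \<open>The Lipschitz constant on a ball is the same for all \<open>v\<close>, so continuity in
  \<open>v\<close> for fixed state upgrades to joint continuity. This makes the integrands of mild
  solutions continuous, hence integrable.\<close>

lemma continuous_on_lipschitz_on_bounded:
  fixes f :: "'x::banach \<Rightarrow> 'u::banach \<Rightarrow> 'x"
  assumes lip: "lipschitz_on_bounded_uniformly f" and cont: "\<And>x. continuous_on UNIV (f x)"
    and x: "continuous_on S x" and u: "continuous_on S u"
  shows "continuous_on S (\<lambda>s. f (x s) (u s))"
proof -
  have "local_lipschitz UNIV UNIV (\<lambda>v y. f y v)"
  proof (rule local_lipschitzI)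
    fix v :: 'u and y :: 'x
    have "norm y + 1 > 0" by (simp add: add_nonneg_pos)
    then obtain L where L: "L > 0"
      "\<And>v z1 z2. norm z1 \<le> norm y + 1 \<Longrightarrow> norm z2 \<le> norm y + 1 \<Longrightarrow> norm (f z2 v - f z1 v) \<le> L * norm (z2 - z1)"
      using lip unfolding lipschitz_on_bounded_uniformly_def by meson
    have "norm z \<le> norm y + 1" if "dist y z \<le> 1" for z
      using that norm_triangle_ineq2[of z y] by (simp add: dist_norm norm_minus_commute)
    then have "L-lipschitz_on (cball y 1 \<inter> UNIV) (\<lambda>y. f y s)" for s
      using L by (intro lipschitz_onI) (auto simp: dist_norm)
    then show "\<exists>r>0. \<exists>L. \<forall>s\<in>cball v r \<inter> UNIV. L-lipschitz_on (cball y r \<inter> UNIV) (\<lambda>y. f y s)"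
      by (intro exI[of _ "1::real"] conjI exI[of _ L] ballI) simp_all
  qed
  then have "continuous_on (UNIV \<times> UNIV) (\<lambda>(v, y). f y v)"
    by (rule Lipschitz.continuous_on_TimesI) (use cont in auto)
  from continuous_on_compose2[OF this continuous_on_Pair[OF u x]] show ?thesis
    by simp
qed

section \<open>Global existence and bounds for mild solutions\<close>

context exp_stable_family
begin

text \<open>Truncating the state at a time-dependent radius exceeding the a priori bound of
  \<open>mild_estimate\<close> makes the nonlinearity globally Lipschitz on bounded time
  intervals without changing the solution.\<close>

lemma mild_solution_exists:
  fixes f :: "'x \<Rightarrow> 'u::banach \<Rightarrow> 'x"
  assumes lip: "lipschitz_on_bounded_uniformly f" and f_cont: "\<And>x. continuous_on UNIV (f x)"
    and u: "continuous_on {0..} u"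
    and p: "continuous_on {0..} p" and q: "continuous_on {0..} q"
    and p_nonneg: "\<And>s. 0 \<le> s \<Longrightarrow> 0 \<le> p s" and q_nonneg: "\<And>s. 0 \<le> s \<Longrightarrow> 0 \<le> q s"
    and growth: "\<And>s x. 0 \<le> s \<Longrightarrow> norm (f x (u s)) \<le> p s + norm x * q s"
  shows "\<exists>x. mild_solution T f x0 u x"
proof -
  define P Q where "P t = integral {0..t} p" and "Q t = integral {0..t} q" for t
  have int: "p integrable_on {0..t}" "q integrable_on {0..t}" for t
    by (auto intro!: integrable_continuous_real continuous_on_subset[OF p] continuous_on_subset[OF q])
  have mono: "P s \<le> P t" "Q s \<le> Q t" if "0 \<le> s" "s \<le> t" for s t
    unfolding P_def Q_def
    by (intro integral_subset_le int; use that p_nonneg q_nonneg in auto)+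
  have nonneg: "0 \<le> P t" "0 \<le> Q t" if "0 \<le> t" for t
    using mono[of 0 t] that by (simp_all add: P_def Q_def)
  have P_Q_cont: "continuous_on {0..N} P" "continuous_on {0..N} Q" for N
    unfolding P_def Q_def by (intro indefinite_integral_continuous_1 int)+
  \<comment> \<open>The a priori bound with the decay factor replaced by 1, which makes it
    nondecreasing, so \<open>w N\<close> bounds all radii on \<open>{0..N}\<close>. The summand 1
    makes the radius positive.\<close>
  define w where "w t = (M * norm x0 + M * P t) * exp (M * Q t) + 1" for t
  have w_pos: "0 < w t" if "0 \<le> t" for t
    using nonneg[OF that] M_pos by (auto simp: w_def intro!: add_nonneg_pos mult_nonneg_nonneg)
  have w_mono: "w s \<le> w t" if "0 \<le> s" "s \<le> t" for s t
    unfolding w_def using mono[OF that] nonneg[of s] nonneg[of t] that M_pos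
    by (intro add_right_mono mult_mono) auto
  have w_cont: "continuous_on {0..} w"
    unfolding w_def by (intro continuous_on_halfline continuous_intros P_Q_cont)
  define F where "F s x = f (trunc (w s) x) (u s)" for s x
  have F_cont: "continuous_on {0..} (\<lambda>s. F s (x s))" if "continuous_on {0..} x" for x
    unfolding F_def
    by (intro continuous_on_lipschitz_on_bounded[OF lip f_cont] continuous_on_trunc w_cont that u)
      (use w_pos in auto)
  have F_lip: "\<exists>L>0. \<forall>s\<in>{0..N}. \<forall>x y. norm (F s x - F s y) \<le> L * norm (x - y)" for N
  proof (cases "0 \<le> N")
    case True
    then obtain L where L: "L > 0"
      "\<And>v x y. norm x \<le> w N \<Longrightarrow> norm y \<le> w N \<Longrightarrow> norm (f y v - f x v) \<le> L * norm (y - x)"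
      using lip w_pos[of N] unfolding lipschitz_on_bounded_uniformly_def by meson
    have "norm (F s x - F s y) \<le> (L * 2) * norm (x - y)" if s: "s \<in> {0..N}" for s x y
    proof -
      have le: "norm (trunc (w s) z) \<le> w N" for z :: 'x
        using norm_trunc_le(1)[of "w s" z] w_pos[of s] w_mono[of s N] s by auto
      have "norm (F s x - F s y) \<le> L * norm (trunc (w s) x - trunc (w s) y)"
        unfolding F_def by (intro L(2) le)
      also have "\<dots> \<le> L * (2 * norm (x - y))"
        using L(1) s w_pos[of s] by (intro mult_left_mono trunc_lipschitz) auto
      finally show ?thesis by simp
    qed
    with L(1) show ?thesis
      by (intro exI[of _ "L * 2"]) auto
  \<comment> \<open>For \<open>N < 0\<close> the interval is empty and any constant works.\<close>
  qed (auto intro: exI[of _ 1])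
  obtain x where x: "continuous_on {0..} x"
    and eq: "\<And>t. 0 \<le> t \<Longrightarrow> x t = T t x0 + convolution (\<lambda>s. F s (x s)) t"
    using integral_equation_solution[OF F_cont F_lip] by metis
  have F_eq: "F t (x t) = f (x t) (u t)" if t: "0 \<le> t" for t
  proof -
    have "norm (x t) \<le> (M * exp (- \<omega> * t) * norm x0 + M * P t) * exp (M * Q t)"
      unfolding P_def Q_def
    \<comment> \<open>Truncation does not increase the norm, so \<open>F\<close> obeys the same
      growth bound as \<open>f\<close>; the resulting estimate keeps \<open>x\<close> inside the
      radius \<open>w\<close>, where \<open>F\<close> and \<open>f\<close> agree.\<close>
    proof (rule mild_estimate[OF t x F_cont[OF x] p q p_nonneg q_nonneg _ eq])
      fix s :: real assume s: "0 \<le> s"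
      have "norm (F s (x s)) \<le> p s + norm (trunc (w s) (x s)) * q s"
        unfolding F_def by (rule growth[OF s])
      also have "\<dots> \<le> p s + norm (x s) * q s"
        by (intro add_left_mono mult_right_mono norm_trunc_le w_pos q_nonneg s)
      finally show "norm (F s (x s)) \<le> p s + norm (x s) * q s" .
    qed auto
    also have "\<dots> \<le> w t"
    proof -
      have "M * exp (- \<omega> * t) * norm x0 \<le> M * 1 * norm x0"
        using t M_pos rate_pos by (intro mult_right_mono mult_left_mono) auto
      then have "(M * exp (- \<omega> * t) * norm x0 + M * P t) * exp (M * Q t) \<le> (M * norm x0 + M * P t) * exp (M * Q t)"
        by (intro mult_right_mono[OF add_right_mono]) auto
      then show ?thesis unfolding w_def by linarith
    qed
    finally show ?thesis
      unfolding F_def using w_pos[OF t] by (simp add: trunc_eq_self)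
  qed
  have f_x: "continuous_on {0..} (\<lambda>s. f (x s) (u s))"
    by (intro continuous_on_lipschitz_on_bounded[OF lip f_cont] x u)
  have conv_eq: "convolution (\<lambda>s. F s (x s)) t = convolution (\<lambda>s. f (x s) (u s)) t" for t
    unfolding convolution_def by (rule integral_cong) (simp add: F_eq)
  have "x 0 = x0"
    using eq[of 0] at_zero by (simp add: convolution_def)
  then have "mild_solution T f x0 u x"
    unfolding mild_solution_def
    using x eq conv_eq convolution_integrable[OF f_x] by (auto simp: convolution_def)
  then show ?thesis by blast
qed

text \<open>The estimate covers an arbitrary mild solution, as the bound in \<open>iISS\<close>
  demands.\<close>

lemma mild_solution_bound:
  fixes f :: "'x \<Rightarrow> 'u::banach \<Rightarrow> 'x"
  assumes lip: "lipschitz_on_bounded_uniformly f" and f_cont: "\<And>x. continuous_on UNIV (f x)"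
    and u: "continuous_on {0..} u"
    and p: "continuous_on {0..} p" and q: "continuous_on {0..} q"
    and p_nonneg: "\<And>s. 0 \<le> s \<Longrightarrow> 0 \<le> p s" and q_nonneg: "\<And>s. 0 \<le> s \<Longrightarrow> 0 \<le> q s"
    and growth: "\<And>s x. 0 \<le> s \<Longrightarrow> norm (f x (u s)) \<le> p s + norm x * q s"
    and sol: "mild_solution T f x0 u x" and t: "0 \<le> t"
  shows "norm (x t) \<le> (M * exp (- \<omega> * t) * norm x0 + M * integral {0..t} p) * exp (M * integral {0..t} q)"
proof -
  have x: "continuous_on {0..} x"
    and eq: "\<And>t. 0 \<le> t \<Longrightarrow> x t = T t x0 + convolution (\<lambda>s. f (x s) (u s)) t"
    using sol by (auto simp: mild_solution_def convolution_def)
  show ?thesis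
    by (rule mild_estimate[OF t x continuous_on_lipschitz_on_bounded[OF lip f_cont x u]
          p q p_nonneg q_nonneg growth eq])
qed

end

section \<open>From 0-UGASs to exponential stability of the semigroup\<close>

text \<open>As \<open>f\<close> vanishes at zero input, the integral term drops out and the mild
  solution is the orbit itself, which inherits both its bound and its continuity.\<close>

lemma zero_UGASs_orbits:
  assumes "zero_UGASs T f" and "\<And>x. f x 0 = 0"
  obtains \<beta> where "\<beta> \<in> class_KL" "\<And>x t. 0 \<le> t \<Longrightarrow> norm (T t x) \<le> \<beta> (norm x) t"
    "\<And>x. continuous_on {0..} (\<lambda>t. T t x)"
proof -
  obtain \<beta> where \<beta>: "\<beta> \<in> class_KL"
    and ex: "\<And>\<phi>0. \<exists>x. mild_solution T f \<phi>0 (\<lambda>_. 0) x"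
    and le: "\<And>\<phi>0 x t. mild_solution T f \<phi>0 (\<lambda>_. 0) x \<Longrightarrow> 0 \<le> t \<Longrightarrow> norm (x t) \<le> \<beta> (norm \<phi>0) t"
    using assms(1) unfolding zero_UGASs_def by blast
  have orbit: "continuous_on {0..} (\<lambda>t. T t x) \<and> (\<forall>t\<ge>0. norm (T t x) \<le> \<beta> (norm x) t)" for x
  proof -
    obtain y where y: "mild_solution T f x (\<lambda>_. 0) y"
      using ex by blast
    then have eq: "y t = T t x" if "0 \<le> t" for t
      using that by (simp add: mild_solution_def assms(2))
    have "continuous_on {0..} y"
      using y by (simp add: mild_solution_def)
    then have "continuous_on {0..} (\<lambda>t. T t x)"
      by (rule continuous_on_eq) (simp add: eq)
    with le[OF y] show ?thesis by (simp add: eq)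
  qed
  show thesis
    by (rule that[OF \<beta>]) (use orbit in auto)
qed

text \<open>Linearity turns the bound on the unit sphere into
  \<open>norm (T t) \<le> \<beta> 1 t\<close>. Since this tends to 0, some \<open>T \<tau>\<close>
  has norm below 1/2, and the semigroup law yields geometric decay along multiples of
  \<open>\<tau>\<close>.\<close>

lemma C0_semigroup_exp_stable:
  assumes T: "C0_semigroup T" and \<beta>: "\<beta> \<in> class_KL"
    and le: "\<And>x t. 0 \<le> t \<Longrightarrow> norm (T t x) \<le> \<beta> (norm x) t"
    and cont: "\<And>x. continuous_on {0..} (\<lambda>t. T t x)"
  obtains M \<omega> where "exp_stable_family T M \<omega>"
proof -
  have T_0: "T 0 = id_blinfun"
    and T_add: "\<And>s t. 0 \<le> s \<Longrightarrow> 0 \<le> t \<Longrightarrow> T (s + t) = T s o\<^sub>L T t"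
    using T by (auto simp: C0_semigroup_def)
  have nonneg: "0 \<le> \<beta> 1 t" if "0 \<le> t" for t
    using \<beta> that by (simp add: class_KL_def)
  have L: "\<beta> 1 \<in> class_L"
    using \<beta> by (simp add: class_KL_def)
  have norm_T: "norm (T t) \<le> \<beta> 1 t" if t: "0 \<le> t" for t
  proof (rule norm_blinfun_bound[OF nonneg[OF t]])
    fix x
    show "norm (T t x) \<le> \<beta> 1 t * norm x"
    proof (cases "x = 0")
      case False
      then have "norm (T t (x /\<^sub>R norm x)) \<le> \<beta> 1 t"
        using le[OF t, of "x /\<^sub>R norm x"] by simp
      with False show ?thesis
        by (simp add: blinfun.scaleR_right divide_simps)
    qed simp
  qed
  define c where "c = \<beta> 1 0 + 1"
  have c: "c > 0" using nonneg[of 0] by (simp add: c_def)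
  have norm_T_c: "norm (T t) \<le> c" if t: "0 \<le> t" for t
  proof -
    have "\<beta> 1 t \<le> \<beta> 1 0"
      using L t by (cases "t = 0") (auto simp: class_L_def monotone_on_def less_imp_le)
    with norm_T[OF t] show ?thesis by (simp add: c_def)
  qed
  have "(\<beta> 1 \<longlongrightarrow> 0) at_top"
    using L by (simp add: class_L_def)
  then have "\<forall>\<^sub>F t in at_top. \<beta> 1 t < 1 / 2"
    by (rule order_tendstoD) simp
  then have "\<forall>\<^sub>F t in at_top. \<beta> 1 t < 1 / 2 \<and> t > 0"
    using eventually_gt_at_top by (rule eventually_conj)
  then obtain \<tau> where \<tau>: "\<beta> 1 \<tau> < 1 / 2" "\<tau> > 0"
    using eventually_happens'[of "at_top :: real filter"] by auto
  have power: "norm (T (real n * \<tau>)) \<le> (1 / 2) ^ n" for n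
  proof (induction n)
    case 0
    then show ?case by (simp add: T_0 norm_blinfun_id_le)
  next
    case (Suc n)
    have "T (real (Suc n) * \<tau>) = T \<tau> o\<^sub>L T (real n * \<tau>)"
      using T_add[of \<tau> "real n * \<tau>"] \<tau> by (simp add: algebra_simps)
    then have "norm (T (real (Suc n) * \<tau>)) \<le> norm (T \<tau>) * norm (T (real n * \<tau>))"
      by (simp add: norm_blinfun_compose)
    also have "\<dots> \<le> (1 / 2) * (1 / 2) ^ n"
      using Suc norm_T[of \<tau>] \<tau> by (intro mult_mono) auto
    finally show ?case by simp
  qed
  \<comment> \<open>Chosen so that \<open>exp (- \<omega> * \<tau>) = 1 / 2\<close>.\<close>
  define \<omega> where "\<omega> = ln 2 / \<tau>"
  have "norm (T t) \<le> 2 * c * exp (- \<omega> * t)" if t: "0 \<le> t" for t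
  proof -
    \<comment> \<open>The number of whole periods \<open>\<tau>\<close> in \<open>t\<close>. As
      \<open>t\<close> may fall short of the next multiple, \<open>(1 / 2) ^ n\<close> is only
      bounded by \<open>2 * exp (- \<omega> * t)\<close>, hence the factor 2 in the
      constant.\<close>
    define n where "n = nat \<lfloor>t / \<tau>\<rfloor>"
    have n: "real n \<le> t / \<tau>" "t / \<tau> < real n + 1"
    proof -
      have "0 \<le> t / \<tau>" using t \<tau> by simp
      then show "real n \<le> t / \<tau>" "t / \<tau> < real n + 1"
        unfolding n_def by linarith+
    qed
    have s: "0 \<le> t - real n * \<tau>"
      using n \<tau> by (simp add: field_simps)
    have "T t = T (t - real n * \<tau>) o\<^sub>L T (real n * \<tau>)"
      using T_add[OF s, of "real n * \<tau>"] \<tau> by simp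
    then have "norm (T t) \<le> norm (T (t - real n * \<tau>)) * norm (T (real n * \<tau>))"
      by (simp add: norm_blinfun_compose)
    also have "\<dots> \<le> c * (1 / 2) ^ n"
      using c by (intro mult_mono norm_T_c s power) auto
    also have "(1 / 2 :: real) ^ n = exp (- (real n * ln 2))"
      by (simp add: exp_minus exp_of_nat_mult power_one_over inverse_eq_divide)
    also have "\<dots> \<le> exp (ln 2 - \<omega> * t)"
    proof -
      have "(t / \<tau>) * ln 2 \<le> (real n + 1) * ln 2"
        using n by (intro mult_right_mono) auto
      then show ?thesis by (simp add: \<omega>_def algebra_simps)
    qed
    also have "exp (ln 2 - \<omega> * t) = 2 * exp (- \<omega> * t)"
      by (simp add: exp_diff exp_minus divide_simps)
    finally show ?thesis
      using c by (simp add: mult_ac)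
  qed
  then have "exp_stable_family T (2 * c) \<omega>"
    using c \<tau> cont T_0 by unfold_locales (auto simp: \<omega>_def)
  then show thesis by (rule that)
qed

section \<open>The comparison functions of the iISS estimate\<close>

text \<open>The strictly increasing \<open>h z = z + z\<^sup>2 / 2\<close> is composed with the
  decaying linear bound; the quadratic part receives the square split off the mixed term.\<close>

lemma class_KL_exp_quadratic:
  assumes M: "0 < M" and \<omega>: "0 < \<omega>"
  shows "(\<lambda>r t. M * exp (- \<omega> * t) * r + (M * exp (- \<omega> * t) * r)\<^sup>2 / 2) \<in> class_KL"
proof -
  define h where "h z = z + z\<^sup>2 / 2" for z :: real
  have h: "h y < h z" if "0 \<le> y" "y < z" for y z
    unfolding h_def using that power_strict_mono[of y z 2] by simp
  have h_nonneg: "0 \<le> h z" if "0 \<le> z" for z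
    using that by (simp add: h_def)
  have h_cont: "continuous_on {0..} (\<lambda>r. h (M * exp (- \<omega> * t) * r))" for t
    unfolding h_def by (intro continuous_intros) simp
  then have "(\<lambda>r. h (M * exp (- \<omega> * t) * r)) \<in> class_K" for t
    unfolding class_K_def
    using M h_cont by (auto simp: strict_mono_on_def intro!: h h_nonneg) (simp add: h_def)
  moreover have "(\<lambda>t. h (M * exp (- \<omega> * t) * r)) \<in> class_L" if r: "0 < r" for r
  proof -
    have "((\<lambda>t. exp (- \<omega> * t)) \<longlongrightarrow> 0) at_top"
      by (intro filterlim_compose[OF exp_at_bot]
          filterlim_tendsto_neg_mult_at_bot[OF tendsto_const _ filterlim_ident]) (use \<omega> in simp)
    then have "((\<lambda>t. h (M * exp (- \<omega> * t) * r)) \<longlongrightarrow> h (M * 0 * r)) at_top"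
      unfolding h_def by (intro tendsto_intros) auto
    moreover have "continuous_on {0..} (\<lambda>t. h (M * exp (- \<omega> * t) * r))"
      unfolding h_def by (intro continuous_intros) auto
    moreover have "strict_antimono_on {0..} (\<lambda>t. h (M * exp (- \<omega> * t) * r))"
      using M \<omega> r by (auto simp: monotone_on_def intro!: h)
    ultimately show ?thesis
      unfolding class_L_def using M r by (auto simp: h_def)
  qed
  moreover have "continuous_on ({0..} \<times> {0..}) (\<lambda>(r, t). h (M * exp (- \<omega> * t) * r))"
    unfolding h_def case_prod_beta by (intro continuous_intros) auto
  ultimately have "(\<lambda>r t. h (M * exp (- \<omega> * t) * r)) \<in> class_KL"
    unfolding class_KL_def using M by (auto intro!: h_nonneg)
  then show ?thesis by (simp add: h_def)
qed

text \<open>The first two summands are merely nondecreasing when \<open>a\<close> and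
  \<open>k\<close> may vanish; the summand \<open>s\<close> supplies strict growth and
  unboundedness.\<close>

lemma class_Kinf_exp_gain:
  assumes a: "0 \<le> a" and k: "0 \<le> k"
  shows "(\<lambda>s. (exp (k * s) - 1)\<^sup>2 / 2 + a * s * exp (k * s) + s) \<in> class_Kinf"
proof -
  let ?\<theta> = "\<lambda>s. (exp (k * s) - 1)\<^sup>2 / 2 + a * s * exp (k * s) + s"
  have ge: "s \<le> ?\<theta> s" if "0 \<le> s" for s
    using that a by simp
  have "?\<theta> r < ?\<theta> s" if "0 \<le> r" "r < s" for r s
  proof -
    have "exp (k * r) \<le> exp (k * s)"
      using that k by (simp add: mult_left_mono)
    then have "(exp (k * r) - 1)\<^sup>2 \<le> (exp (k * s) - 1)\<^sup>2" "a * r * exp (k * r) \<le> a * s * exp (k * s)"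
      using that a k by (auto intro!: power_mono mult_mono)
    with that show ?thesis by simp
  qed
  moreover have \<theta>_cont: "continuous_on {0..} ?\<theta>"
    by (intro continuous_intros) simp
  ultimately have "?\<theta> \<in> class_K"
    unfolding class_K_def using ge \<theta>_cont
    by (auto simp: strict_mono_on_def intro: order_trans)
  moreover have "\<not> bounded (?\<theta> ` {0..})"
  proof
    assume "bounded (?\<theta> ` {0..})"
    then obtain b where b: "b > 0" "\<And>s. 0 \<le> s \<Longrightarrow> \<bar>?\<theta> s\<bar> \<le> b"
      unfolding bounded_pos by auto
    show False
      using b(2)[of "b + 1"] ge[of "b + 1"] b(1) by linarith
  qed
  ultimately show ?thesis
    by (simp add: class_Kinf_def)
qed

section \<open>The two implications\<close>

text \<open>The zero input is admissible, and its gain term vanishes because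
  \<open>\<mu> 0 = 0\<close> and \<open>\<theta> 0 = 0\<close>.\<close>

lemma iISS_imp_zero_UGASs:
  assumes "iISS T f"
  shows "zero_UGASs T f"
proof -
  obtain \<theta> \<mu> \<beta> where \<theta>: "\<theta> \<in> class_Kinf" and \<mu>: "\<mu> \<in> class_K" and \<beta>: "\<beta> \<in> class_KL"
    and *: "\<And>\<phi>0 u. u \<in> admissible_inputs \<Longrightarrow> (\<exists>x. mild_solution T f \<phi>0 u x)
        \<and> (\<forall>x. mild_solution T f \<phi>0 u x \<longrightarrow>
              (\<forall>t\<ge>0. norm (x t) \<le> \<beta> (norm \<phi>0) t + \<theta> (integral {0..t} (\<lambda>s. \<mu> (norm (u s))))))"
    using assms unfolding iISS_def by blast
  have "(\<lambda>_. 0) \<in> admissible_inputs"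
    by (auto simp: admissible_inputs_def bounded_iff)
  note * = *[OF this]
  have "\<theta> 0 = 0" "\<mu> 0 = 0"
    using \<theta> \<mu> by (auto simp: class_Kinf_def class_K_def)
  with * \<beta> show ?thesis
    unfolding zero_UGASs_def by (auto intro!: bexI[of _ \<beta>])
qed

theorem theorem3:
  fixes D :: "'x::banach set"
    and A :: "'x \<Rightarrow> 'x"
    and T :: "real \<Rightarrow> 'x \<Rightarrow>\<^sub>L 'x"
    and B :: "'u::banach \<Rightarrow>\<^sub>L 'x"
    and C f :: "'x \<Rightarrow> 'u \<Rightarrow> 'x"
  assumes "generates_C0_semigroup D A T"
    and "\<exists>K>0. \<exists>\<xi>\<in>class_K. \<forall>x v. norm (C x v) \<le> K * norm x * \<xi> (norm v)"
    and "\<forall>x v. f x v = blinfun_apply B v + C x v"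
    and "lipschitz_on_bounded_uniformly f"
    and "\<forall>x. continuous_on UNIV (f x)"
  shows "iISS T f \<longleftrightarrow> zero_UGASs T f"
proof
  show "iISS T f \<Longrightarrow> zero_UGASs T f"
    by (rule iISS_imp_zero_UGASs)
next
  assume UGAS: "zero_UGASs T f"
  obtain K \<xi> where K: "K > 0" and \<xi>: "\<xi> \<in> class_K"
    and C: "\<And>x v. norm (C x v) \<le> K * norm x * \<xi> (norm v)"
    using assms(2) by blast
  have \<xi>_0: "\<xi> 0 = 0" and \<xi>_nonneg: "\<And>r. 0 \<le> r \<Longrightarrow> 0 \<le> \<xi> r" and \<xi>_cont: "continuous_on {0..} \<xi>"
    and \<xi>_mono: "\<And>r s. 0 \<le> r \<Longrightarrow> r < s \<Longrightarrow> \<xi> r < \<xi> s"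
    using \<xi> by (auto simp: class_K_def strict_mono_on_def)
  have f_0: "f x 0 = 0" for x
    using C[of x 0] assms(3) \<xi>_0 by simp
  obtain \<beta> where "\<beta> \<in> class_KL" "\<And>x t. 0 \<le> t \<Longrightarrow> norm (T t x) \<le> \<beta> (norm x) t"
    "\<And>x. continuous_on {0..} (\<lambda>t. T t x)"
    by (rule zero_UGASs_orbits[OF UGAS f_0]) blast
  moreover have "C0_semigroup T"
    using assms(1) by (simp add: generates_C0_semigroup_def)
  ultimately obtain M \<omega> where "exp_stable_family T M \<omega>"
    using C0_semigroup_exp_stable by metis
  then interpret exp_stable_family T M \<omega> .

  have growth: "norm (f x v) \<le> norm B * norm v + norm x * (K * \<xi> (norm v))" for x v
    using C[of x v] norm_blinfun[of B v] norm_triangle_ineq[of "B v" "C x v"] assms(3)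
    by (simp add: mult_ac)

  \<comment> \<open>One integral of this sum dominates both the integral of
    \<open>norm (u s)\<close>, which stems from \<open>B\<close>, and that of
    \<open>\<xi> (norm (u s))\<close>, which stems from \<open>C\<close>.\<close>
  define \<mu> where "\<mu> r = r + \<xi> r" for r
  have \<mu>: "\<mu> \<in> class_K"
    unfolding class_K_def \<mu>_def
    by (auto simp: strict_mono_on_def \<xi>_0 \<xi>_nonneg intro!: continuous_on_add continuous_on_id \<xi>_cont add_strict_mono \<xi>_mono)
  define k where "k = M * K"
  define a where "a = M * norm B"
  have a: "0 \<le> a" and k: "0 \<le> k"
    using M_pos K by (simp_all add: a_def k_def)
  let ?\<theta> = "\<lambda>s. (exp (k * s) - 1)\<^sup>2 / 2 + a * s * exp (k * s) + s"
  let ?\<beta> = "\<lambda>r t. M * exp (- \<omega> * t) * r + (M * exp (- \<omega> * t) * r)\<^sup>2 / 2"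

  have main: "(\<exists>x. mild_solution T f \<phi>0 u x)
        \<and> (\<forall>x. mild_solution T f \<phi>0 u x \<longrightarrow>
              (\<forall>t\<ge>0. norm (x t) \<le> ?\<beta> (norm \<phi>0) t + ?\<theta> (integral {0..t} (\<lambda>s. \<mu> (norm (u s))))))"
    if "u \<in> admissible_inputs" for \<phi>0 u
  proof (intro conjI allI impI)
    have u: "continuous_on {0..} u"
      using that by (simp add: admissible_inputs_def)
    have \<xi>_u: "continuous_on {0..} (\<lambda>s. \<xi> (norm (u s)))"
      by (rule continuous_on_compose2[OF \<xi>_cont]) (auto intro!: continuous_on_norm u)
    have p: "continuous_on {0..} (\<lambda>s. norm B * norm (u s))"
      by (intro continuous_intros u)
    have q: "continuous_on {0..} (\<lambda>s. K * \<xi> (norm (u s)))"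
      by (intro continuous_intros \<xi>_u)
    have q_nonneg: "0 \<le> K * \<xi> (norm (u s))" for s
      using K \<xi>_nonneg by simp
    note hyps = assms(4) assms(5)[rule_format] u p q _ q_nonneg growth
    show "\<exists>x. mild_solution T f \<phi>0 u x"
      by (rule mild_solution_exists[OF hyps]) simp
    fix x t assume sol: "mild_solution T f \<phi>0 u x" and t: "(0::real) \<le> t"
    define I where "I = integral {0..t} (\<lambda>s. \<mu> (norm (u s)))"
    define r where "r = M * exp (- \<omega> * t) * norm \<phi>0"
    have r: "0 \<le> r" using M_pos by (simp add: r_def)
    have int_u: "(\<lambda>s. norm (u s)) integrable_on {0..t}"
      by (intro integrable_continuous_real continuous_intros continuous_on_subset[OF u]) auto
    have int_\<xi>: "(\<lambda>s. \<xi> (norm (u s))) integrable_on {0..t}"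
      by (intro integrable_continuous_real continuous_on_subset[OF \<xi>_u]) auto
    have I_eq: "I = integral {0..t} (\<lambda>s. norm (u s)) + integral {0..t} (\<lambda>s. \<xi> (norm (u s)))"
      unfolding I_def \<mu>_def by (rule integral_add[OF int_u int_\<xi>])
    have nonneg: "0 \<le> integral {0..t} (\<lambda>s. norm (u s))" "0 \<le> integral {0..t} (\<lambda>s. \<xi> (norm (u s)))"
      by (intro integral_nonneg int_u int_\<xi>; simp add: \<xi>_nonneg)+
    then have I: "0 \<le> I" and I_ge: "integral {0..t} (\<lambda>s. norm (u s)) \<le> I" "integral {0..t} (\<lambda>s. \<xi> (norm (u s))) \<le> I"
      by (simp_all add: I_eq)
    have "norm (x t) \<le> (r + M * integral {0..t} (\<lambda>s. norm B * norm (u s)))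
        * exp (M * integral {0..t} (\<lambda>s. K * \<xi> (norm (u s))))"
      unfolding r_def by (rule mild_solution_bound[OF hyps sol t]) simp
    also have "\<dots> = (r + a * integral {0..t} (\<lambda>s. norm (u s))) * exp (k * integral {0..t} (\<lambda>s. \<xi> (norm (u s))))"
      by (simp add: a_def k_def mult.assoc)
    also have "\<dots> \<le> (r + a * I) * exp (k * I)"
      using I_ge a k r I by (intro mult_mono add_left_mono mult_left_mono) (auto intro: mult_left_mono)
    \<comment> \<open>Splitting off \<open>r\<close> leaves the factor
      \<open>exp (k * I) - 1\<close>, which vanishes at \<open>I = 0\<close>, so that its square can
      enter the gain.\<close>
    also have "\<dots> = r + r * (exp (k * I) - 1) + a * I * exp (k * I)"
      by (simp add: algebra_simps)
    also have "r * (exp (k * I) - 1) \<le> r\<^sup>2 / 2 + (exp (k * I) - 1)\<^sup>2 / 2"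
      using sum_squares_bound[of r "exp (k * I) - 1"] by simp
    also have "r + (r\<^sup>2 / 2 + (exp (k * I) - 1)\<^sup>2 / 2) + a * I * exp (k * I) \<le> (r + r\<^sup>2 / 2) + ?\<theta> I"
      using I by simp
    finally show "norm (x t) \<le> ?\<beta> (norm \<phi>0) t + ?\<theta> (integral {0..t} (\<lambda>s. \<mu> (norm (u s))))"
      by (simp add: r_def I_def)
  qed
  show "iISS T f"
    unfolding iISS_def
    by (rule bexI[of _ ?\<theta>], rule bexI[of _ \<mu>], rule bexI[of _ ?\<beta>])
      (use main \<mu> class_KL_exp_quadratic[OF M_pos rate_pos] class_Kinf_exp_gain[OF a k] in blast)+
qed

end
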